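(* Let $a<b$ be reals, $d\in\mathbb{N}^*$ and $0<\alpha\le 1$. Let $f,g\in\mathscr{C}^\infty([a,b],\mathbb{R}^d)$ be such that the two sequences of functions $\big(I^{p-\alpha}_-f\cdot g^{(p)}\big)_{p\in\mathbb{N}^*}$ and $\big(f^{(p)}\cdot I^{p-\alpha}_+g\big)_{p\in\mathbb{N}^*}$ converge uniformly to $0$ on $[a,b]$. Then the following equality holds on $(a,b)$: $$D^\alpha_-f\cdot g-f\cdot D^\alpha_+g=\frac{d}{dt}\left[\sum_{r=0}^{\infty}(-1)^r\,I^{r+1-\alpha}_-f\cdot g^{(r)}+f^{(r)}\cdot I^{r+1-\alpha}_+g\right].$$
   Context: $\mathbb{N}^*$ is the set of positive integers, $\cdot$ is the Euclidean scalar product on $\mathbb{R}^d$ (taken pointwise in $t$ for functions), and $f^{(r)}$ is the $r$-th classical derivative. For $\beta>0$ the left and right Riemann-Liouville fractional integrals of order $\beta$ are $$I^\beta_-f(t)=\frac{1}{\Gamma(\beta)}\int_a^t(t-y)^{\beta-1}f(y)\,dy\ \ (t\in(a,b]),\qquad I^\beta_+f(t)=\frac{1}{\Gamma(\beta)}\int_t^b(y-t)^{\beta-1}f(y)\,dy\ \ (t\in[a,b)),$$ where $\Gamma$ is Euler's Gamma function; for continuous $f$ they are extended by continuity with $I^\beta_-f(a)=0$ and $I^\beta_+f(b)=0$. For $\beta=0$, $I^0_-f=I^0_+f=f$. For $0<\alpha\le1$ the left and right Riemann-Liouville fractional derivatives are $$D^\alpha_-f(t)=\frac{d}{dt}\big(I^{1-\alpha}_-f\big)(t)\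 \ (t\in(a,b]),\qquad D^\alpha_+f(t)=-\frac{d}{dt}\big(I^{1-\alpha}_+f\big)(t)\ \ (t\in[a,b)).$$ In the bracket, both terms $(-1)^rI^{r+1-\alpha}_-f\cdot g^{(r)}$ and $f^{(r)}\cdot I^{r+1-\alpha}_+g$ are summed over $r$. *)

theory Defs
  imports "HOL-Analysis.Analysis"
begin

text \<open>
  The derivative at an endpoint of \<open>[a, b]\<close> is one-sided, and values outside \<open>[a, b]\<close> are
  irrelevant; at an interior point this is the ordinary derivative.
\<close>

primrec nth_deriv :: "real \<Rightarrow> real \<Rightarrow> nat \<Rightarrow> (real \<Rightarrow> 'a::real_normed_vector) \<Rightarrow> real \<Rightarrow> 'a" where
  "nth_deriv a b 0 f = f"
| "nth_deriv a b (Suc r) f = (\<lambda>t. vector_derivative (nth_deriv a b r f) (at t within {a..b}))"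

definition smooth_on_interval :: "real \<Rightarrow> real \<Rightarrow> (real \<Rightarrow> 'a::real_normed_vector) \<Rightarrow> bool" where
  "smooth_on_interval a b f \<longleftrightarrow> (\<forall>r. nth_deriv a b r f differentiable_on {a..b})"

text \<open>
  Riemann-Liouville fractional integrals of order \<open>\<beta> \<ge> 0\<close> (negative orders are meaningless). For
  \<open>\<beta> > 0\<close> the integral over the degenerate interval at \<open>t = a\<close> (resp. \<open>t = b\<close>) is \<open>0\<close>, which is the
  value of the extension by continuity when \<open>f\<close> is continuous. The convention \<open>0 powr x = 0\<close> only
  affects the kernel at the single point \<open>y = t\<close>.
\<close>

definition rl_integral_left :: "real \<Rightarrow> real \<Rightarrow> (real \<Rightarrow> 'a::euclidean_space) \<Rightarrow> real \<Rightarrow> 'a" where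
  "rl_integral_left a \<beta> f t =
     (if \<beta> = 0 then f t
      else (1 / Gamma \<beta>) *\<^sub>R integral {a..t} (\<lambda>y. (t - y) powr (\<beta> - 1) *\<^sub>R f y))"

definition rl_integral_right :: "real \<Rightarrow> real \<Rightarrow> (real \<Rightarrow> 'a::euclidean_space) \<Rightarrow> real \<Rightarrow> 'a" where
  "rl_integral_right b \<beta> f t =
     (if \<beta> = 0 then f t
      else (1 / Gamma \<beta>) *\<^sub>R integral {t..b} (\<lambda>y. (y - t) powr (\<beta> - 1) *\<^sub>R f y))"

text \<open>
  Riemann-Liouville fractional derivatives of order \<open>0 < \<alpha> \<le> 1\<close>, meaningful for \<open>t\<close> in \<open>(a, b]\<close>
  on the left and for \<open>t\<close> in \<open>[a, b)\<close> on the right.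
\<close>

definition rl_deriv_left ::
    "real \<Rightarrow> real \<Rightarrow> real \<Rightarrow> (real \<Rightarrow> 'a::euclidean_space) \<Rightarrow> real \<Rightarrow> 'a" where
  "rl_deriv_left a b \<alpha> f t =
     vector_derivative (rl_integral_left a (1 - \<alpha>) f) (at t within {a..b})"

definition rl_deriv_right ::
    "real \<Rightarrow> real \<Rightarrow> real \<Rightarrow> (real \<Rightarrow> 'a::euclidean_space) \<Rightarrow> real \<Rightarrow> 'a" where
  "rl_deriv_right a b \<alpha> f t =
     - vector_derivative (rl_integral_right b (1 - \<alpha>) f) (at t within {a..b})"

end

theory Submission
  imports Defs
begin

text \<open>
  Write \<open>v\<^sub>p = I\<^sub>-\<^sup>p\<^sup>-\<^sup>\<alpha> f \<bullet> g\<^sup>(\<^sup>p\<^sup>)\<close> and \<open>w\<^sub>p = f\<^sup>(\<^sup>p\<^sup>) \<bullet> I\<^sub>+\<^sup>p\<^sup>-\<^sup>\<alpha> g\<close>, the two families that tend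
  uniformly to 0. Raising the order of a fractional integral by one is taking a primitive:
  \<open>I\<^sub>-\<close> of order \<open>\<beta> + 1\<close> has derivative \<open>I\<^sub>-\<close> of order \<open>\<beta>\<close>, and \<open>I\<^sub>+\<close> the same with a minus
  sign. By the product rule, for \<open>r \<ge> 1\<close> the \<open>r\<close>-th left term of the series has derivative
  \<open>(-1)\<^sup>r (v\<^sub>r + v\<^sub>r\<^sub>+\<^sub>1)\<close> and the \<open>r\<close>-th right term \<open>w\<^sub>r\<^sub>+\<^sub>1 - w\<^sub>r\<close>. Both families of derivatives
  telescope, so each of the two series of derivatives converges uniformly on \<open>[a, b]\<close>, to \<open>-v\<^sub>1\<close>
  and \<open>-w\<^sub>1\<close>. The terms of index 0 contribute \<open>D\<^sub>-\<^sup>\<alpha> f \<bullet> g + v\<^sub>1\<close> and \<open>w\<^sub>1 - f \<bullet> D\<^sub>+\<^sup>\<alpha> g\<close> at interior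
  points, and everything but the asserted derivative cancels.

  To differentiate a series termwise, uniform convergence of the derivatives has to be complemented
  by convergence at one point. The hypotheses do not bound the terms of the series themselves, but
  the left terms with \<open>r \<ge> 1\<close> all vanish at \<open>a\<close> and the right ones all vanish at \<open>b\<close>. The
  two halves therefore converge separately, each anchored at its own endpoint. This is
  \<open>telescoping_series_has_derivative\<close>.

  The differentiation rule for fractional integrals is delicate because the kernel
  \<open>(t - y) powr (\<beta> - 1)\<close> is singular when \<open>\<beta> < 1\<close>. For \<open>\<beta> > 1\<close> one can differentiate under the
  integral sign. Integration by parts (\<open>rl_integral_left_by_parts\<close>) trades one derivative of \<open>f\<close>
  for one order of integration and so reduces every positive order to that case. The same formula
  shows that \<open>I\<^sub>-\<^sup>1\<^sup>-\<^sup>\<alpha> f\<close>, which may be singular at \<open>a\<close>, is differentiable on the open interval, so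
  that the fractional derivatives exist there. Statements about right integrals follow from those about
  left ones by the reflection \<open>t \<mapsto> -t\<close>.
\<close>

section \<open>Left Riemann-Liouville integrals\<close>

text \<open>
  The truncated power \<open>max 0 (s - y) powr p\<close> turns an integral over \<open>[a, s]\<close> into one over the fixed
  interval \<open>[a, b]\<close>. For \<open>p > 1\<close> it is continuously differentiable even where the truncation sets
  in, which is what differentiation under the integral sign asks for.
\<close>
lemma truncated_powr_has_derivative:
  fixes p x :: real
  assumes "p > 1"
  shows "((\<lambda>x. max 0 x powr p) has_real_derivative p * max 0 x powr (p - 1)) (at x)"
proof -
  consider "x > 0" | "x < 0" | "x = 0" by linarith
  then show ?thesis
  proof cases
    case 1
    have "((\<lambda>x. x powr p) has_real_derivative p * max 0 x powr (p - 1)) (at x)"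
      using 1 by (auto intro!: derivative_eq_intros has_real_derivative_powr simp: max_def)
    then show ?thesis
      by (rule has_field_derivative_transform_within_open[of _ _ _ "{0<..}"]) (use 1 in auto)
  next
    case 2
    have "((\<lambda>x. 0) has_real_derivative p * max 0 x powr (p - 1)) (at x)"
      using 2 by (auto simp: max_def)
    then show ?thesis
      by (rule has_field_derivative_transform_within_open[of _ _ _ "{..<0}"]) (use 2 in auto)
  next
    case 3
    have lim: "((\<lambda>h::real. \<bar>h\<bar> powr (p - 1)) \<longlongrightarrow> 0) (at 0)"
      using assms by (intro tendsto_eq_intros tendsto_zero_powrI) auto
    have bound: "\<forall>h. norm (max 0 h powr p / h) \<le> \<bar>h\<bar> powr (p - 1)"
    proof
      fix h :: real
      show "norm (max 0 h powr p / h) \<le> \<bar>h\<bar> powr (p - 1)"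
      proof (cases "h > 0")
        case True
        then show ?thesis by (simp add: powr_diff)
      next
        case False
        then have "max 0 h = 0" by simp
        then show ?thesis by (simp only: powr_0 div_0 norm_zero powr_ge_zero)
      qed
    qed
    have "((\<lambda>h. max 0 h powr p / h) \<longlongrightarrow> 0) (at 0)"
      by (rule Lim_null_comparison[OF always_eventually[OF bound] lim])
    then show ?thesis
      using 3 assms by (simp add: DERIV_def)
  qed
qed

corollary truncated_powr_shift_has_derivative:
  fixes p x c :: real
  assumes "p > 1"
  shows "((\<lambda>x. max 0 (x - c) powr p) has_real_derivative p * max 0 (x - c) powr (p - 1))
    (at x within S)"
proof -
  have "((\<lambda>x. max 0 (x - c) powr p) has_real_derivative p * max 0 (x - c) powr (p - 1)) (at x)"
    using DERIV_shift[of "\<lambda>x. max 0 x powr p" "p * max 0 (x - c) powr (p - 1)" x "- c"]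
      truncated_powr_has_derivative[OF assms, of "x - c"] by simp
  then show ?thesis by (rule DERIV_subset) simp
qed

lemma rl_integral_left_base: "\<beta> > 0 \<Longrightarrow> rl_integral_left a \<beta> f a = 0"
  by (simp add: rl_integral_left_def)

text \<open>
  The antiderivative \<open>- (t - y) powr \<beta> / \<beta>\<close> of the singular kernel is continuous up to \<open>y = t\<close> and
  vanishes there. Hence the fundamental theorem of calculus with derivatives required only in the
  interior applies, and it yields the integrability of the singular integrand along with its value.
  The formula makes visible how \<open>I\<^sub>-\<^sup>\<beta> f\<close> behaves at \<open>a\<close>: all the irregularity sits in the explicit
  power of \<open>t - a\<close>.
\<close>
lemma rl_integral_left_by_parts:
  fixes f :: "real \<Rightarrow> 'a::euclidean_space"
  assumes "\<beta> > 0" and t: "t \<in> {a..b}"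
    and f': "\<And>t. t \<in> {a..b} \<Longrightarrow> (f has_vector_derivative f' t) (at t within {a..b})"
    and cont: "continuous_on {a..b} f'"
  shows "rl_integral_left a \<beta> f t =
    ((t - a) powr \<beta> / Gamma (\<beta> + 1)) *\<^sub>R f a + rl_integral_left a (\<beta> + 1) f' t"
proof -
  define k where "k = (\<lambda>y. (t - y) powr \<beta>)"
  have "continuous_on {a..b} f"
    using f' by (meson continuous_on_eq_continuous_within has_vector_derivative_continuous)
  then have cf: "continuous_on {a..t} f" "continuous_on {a..t} f'"
    using t cont by (auto elim: continuous_on_subset)
  have ck: "continuous_on {a..t} k"
    unfolding k_def using assms(1) by (intro continuous_intros continuous_on_powr') auto
  have parts: "((\<lambda>y. (t - y) powr (\<beta> - 1) *\<^sub>R f y - (k y / \<beta>) *\<^sub>R f' y)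
      has_integral (- (k t / \<beta>) *\<^sub>R f t - - (k a / \<beta>) *\<^sub>R f a)) {a..t}"
  proof (rule fundamental_theorem_of_calculus_interior)
    show "a \<le> t" using t by simp
    show "continuous_on {a..t} (\<lambda>y. - (k y / \<beta>) *\<^sub>R f y)"
      using cf ck assms(1) by (intro continuous_intros) auto
    fix y assume y: "y \<in> {a<..<t}"
    have df: "(f has_vector_derivative f' y) (at y)"
      using f'[of y] y t by (simp add: at_within_Icc_at)
    have dk: "((\<lambda>y. - (k y / \<beta>)) has_real_derivative (t - y) powr (\<beta> - 1)) (at y)"
      unfolding k_def using y assms(1) by (auto intro!: derivative_eq_intros has_real_derivative_powr)
    show "((\<lambda>y. - (k y / \<beta>) *\<^sub>R f y) has_vector_derivative
        (t - y) powr (\<beta> - 1) *\<^sub>R f y - (k y / \<beta>) *\<^sub>R f' y) (at y)"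
      using has_vector_derivative_scaleR[OF dk df] by (simp add: add.commute)
  qed
  have int: "(\<lambda>y. (k y / \<beta>) *\<^sub>R f' y) integrable_on {a..t}"
    using cf ck assms(1) by (intro integrable_continuous_real continuous_intros) auto
  have "((\<lambda>y. (t - y) powr (\<beta> - 1) *\<^sub>R f y) has_integral
      (k a / \<beta>) *\<^sub>R f a + integral {a..t} (\<lambda>y. (k y / \<beta>) *\<^sub>R f' y)) {a..t}"
    using has_integral_add[OF parts integrable_integral[OF int]] by (simp add: k_def)
  moreover have "integral {a..t} (\<lambda>y. (k y / \<beta>) *\<^sub>R f' y) = (1 / \<beta>) *\<^sub>R integral {a..t} (\<lambda>y. k y *\<^sub>R f' y)"
    by (simp flip: integral_cmul)
  moreover have "Gamma (\<beta> + 1) = \<beta> * Gamma \<beta>"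
    using assms(1) by (intro Gamma_plus1) (auto dest: nonpos_Ints_nonpos)
  ultimately show ?thesis
    using assms(1) by (simp add: rl_integral_left_def k_def integral_unique scaleR_add_right mult.commute)
qed

text \<open>
  For \<open>\<beta> > 1\<close> the derivative of the kernel of order \<open>\<beta> + 1\<close> is still jointly continuous, so the
  Leibniz rule applies. The factor \<open>\<beta>\<close> it produces is absorbed by \<open>Gamma (\<beta> + 1) = \<beta> * Gamma \<beta>\<close>.
\<close>
lemma rl_integral_left_has_derivative_regular:
  fixes f :: "real \<Rightarrow> 'a::euclidean_space"
  assumes "\<beta> > 1" and t: "t \<in> {a..b}" and cont: "continuous_on {a..b} f"
  shows "(rl_integral_left a (\<beta> + 1) f has_vector_derivative rl_integral_left a \<beta> f t)
    (at t within {a..b})"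
proof -
  have trunc: "integral {a..b} (\<lambda>y. max 0 (s - y) powr p *\<^sub>R f y) =
      integral {a..s} (\<lambda>y. (s - y) powr p *\<^sub>R f y)" if "s \<in> {a..b}" for s p
  proof -
    have "{a..s} \<inter> {a..b} = {a..s}" using that by auto
    then have "integral {a..s} (\<lambda>y. (s - y) powr p *\<^sub>R f y) =
        integral ({a..s} \<inter> {a..b}) (\<lambda>y. max 0 (s - y) powr p *\<^sub>R f y)"
      by (auto intro!: integral_cong)
    also have "\<dots> = integral {a..b} (\<lambda>y. if y \<in> {a..s} then max 0 (s - y) powr p *\<^sub>R f y else 0)"
      by (simp only: Henstock_Kurzweil_Integration.integral_restrict_Int)
    also have "\<dots> = integral {a..b} (\<lambda>y. max 0 (s - y) powr p *\<^sub>R f y)"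
      by (intro integral_cong) auto
    finally show ?thesis by simp
  qed
  have "((\<lambda>s. integral (cbox a b) (\<lambda>y. max 0 (s - y) powr \<beta> *\<^sub>R f y)) has_vector_derivative
      integral (cbox a b) (\<lambda>y. (\<beta> * max 0 (t - y) powr (\<beta> - 1)) *\<^sub>R f y)) (at t within {a..b})"
  proof (rule leibniz_rule_vector_derivative)
    fix s y
    have "((\<lambda>s. max 0 (s - y) powr \<beta>) has_real_derivative \<beta> * max 0 (s - y) powr (\<beta> - 1))
        (at s within {a..b})"
      using assms(1) by (rule truncated_powr_shift_has_derivative)
    then show "((\<lambda>s. max 0 (s - y) powr \<beta> *\<^sub>R f y) has_vector_derivative
        (\<beta> * max 0 (s - y) powr (\<beta> - 1)) *\<^sub>R f y) (at s within {a..b})"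
      using has_vector_derivative_scaleR[OF _ has_vector_derivative_const[of "f y"]] by simp
  next
    fix s
    show "(\<lambda>y. max 0 (s - y) powr \<beta> *\<^sub>R f y) integrable_on cbox a b"
      using assms(1) cont
      by (auto intro!: integrable_continuous_real continuous_intros continuous_on_powr')
  next
    have "continuous_on ({a..b} \<times> {a..b}) (\<lambda>x. f (snd x))"
      by (rule continuous_on_compose2[OF cont]) (auto intro!: continuous_intros)
    then show "continuous_on ({a..b} \<times> cbox a b)
        (\<lambda>(s, y). (\<beta> * max 0 (s - y) powr (\<beta> - 1)) *\<^sub>R f y)"
      using assms(1) unfolding case_prod_unfold
      by (auto intro!: continuous_intros continuous_on_powr')
  qed (use t in auto)
  then have *: "((\<lambda>s. integral {a..b} (\<lambda>y. max 0 (s - y) powr \<beta> *\<^sub>R f y)) has_vector_derivative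
      \<beta> *\<^sub>R integral {a..b} (\<lambda>y. max 0 (t - y) powr (\<beta> - 1) *\<^sub>R f y)) (at t within {a..b})"
    by (simp flip: integral_cmul)
  have G: "Gamma (\<beta> + 1) = \<beta> * Gamma \<beta>"
    using assms(1) by (intro Gamma_plus1) (auto dest: nonpos_Ints_nonpos)
  have "((\<lambda>s. (1 / Gamma (\<beta> + 1)) *\<^sub>R integral {a..b} (\<lambda>y. max 0 (s - y) powr \<beta> *\<^sub>R f y))
      has_vector_derivative rl_integral_left a \<beta> f t) (at t within {a..b})"
    using has_vector_derivative_scaleR[OF DERIV_const *, of "1 / Gamma (\<beta> + 1)"] assms(1) t
    by (simp add: rl_integral_left_def trunc G)
  then show ?thesis
    by (rule has_vector_derivative_transform[OF t, rotated])
       (use assms(1) in \<open>auto simp: rl_integral_left_def trunc\<close>)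
qed

text \<open>
  For \<open>\<beta> > 0\<close>, integrating by parts writes \<open>I\<^sub>-\<close> of order \<open>\<beta> + 1\<close> as a power plus the integral of
  order \<open>\<beta> + 2\<close> of \<open>f'\<close>, to which the regular case applies. Integrating by parts
  once more recognises the result as \<open>I\<^sub>-\<^sup>\<beta> f\<close>. The order \<open>\<beta> = 0\<close> is the fundamental theorem of calculus.
\<close>
lemma rl_integral_left_has_derivative:
  fixes f :: "real \<Rightarrow> 'a::euclidean_space"
  assumes "\<beta> \<ge> 0" and t: "t \<in> {a..b}"
    and f': "\<And>t. t \<in> {a..b} \<Longrightarrow> (f has_vector_derivative f' t) (at t within {a..b})"
    and cont: "continuous_on {a..b} f'"
  shows "(rl_integral_left a (\<beta> + 1) f has_vector_derivative rl_integral_left a \<beta> f t)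
    (at t within {a..b})"
proof (cases "\<beta> = 0")
  case True
  have "continuous_on {a..b} f"
    using f' by (meson continuous_on_eq_continuous_within has_vector_derivative_continuous)
  then have "((\<lambda>s. integral {a..s} f) has_vector_derivative f t) (at t within {a..b})"
    using t by (rule integral_has_vector_derivative)
  \<comment> \<open>The kernel of order 1 is \<open>0 powr 0 = 0\<close> instead of 1 at \<open>y = s\<close>, a negligible set.\<close>
  moreover have "rl_integral_left a 1 f = (\<lambda>s. integral {a..s} f)"
  proof
    fix s
    show "rl_integral_left a 1 f s = integral {a..s} f"
      using integral_spike[of "{s}" "{a..s}" f "\<lambda>y. (s - y) powr 0 *\<^sub>R f y"]
      by (simp add: rl_integral_left_def)
  qed
  moreover have "rl_integral_left a 0 f t = f t"
    by (simp add: rl_integral_left_def)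
  ultimately show ?thesis using True by simp
next
  case False
  with assms(1) have pos: "\<beta> > 0" by simp
  have G: "Gamma (\<beta> + 1 + 1) = (\<beta> + 1) * Gamma (\<beta> + 1)"
    using pos by (intro Gamma_plus1) (auto dest: nonpos_Ints_nonpos)
  \<comment> \<open>Truncating changes nothing on \<open>[a, b]\<close> and makes the power differentiable at \<open>a\<close> as well.\<close>
  have "((\<lambda>s. (max 0 (s - a) powr (\<beta> + 1))) has_real_derivative
      (\<beta> + 1) * max 0 (t - a) powr \<beta>) (at t within {a..b})"
    using truncated_powr_shift_has_derivative[of "\<beta> + 1"] pos by simp
  then have "((\<lambda>s. (max 0 (s - a) powr (\<beta> + 1) / Gamma (\<beta> + 1 + 1)) *\<^sub>R f a
        + rl_integral_left a (\<beta> + 1 + 1) f' s) has_vector_derivative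
      ((\<beta> + 1) * max 0 (t - a) powr \<beta> / Gamma (\<beta> + 1 + 1)) *\<^sub>R f a
        + rl_integral_left a (\<beta> + 1) f' t) (at t within {a..b})"
    using has_vector_derivative_add[OF
      has_vector_derivative_scaleR[OF DERIV_cdivide has_vector_derivative_const[of "f a"]]
      rl_integral_left_has_derivative_regular[of "\<beta> + 1" t a b f', OF _ t cont]] pos
    by simp
  moreover have "((\<beta> + 1) * max 0 (t - a) powr \<beta> / Gamma (\<beta> + 1 + 1)) *\<^sub>R f a
      + rl_integral_left a (\<beta> + 1) f' t = rl_integral_left a \<beta> f t"
    using rl_integral_left_by_parts[OF pos t f' cont] t pos unfolding G by simp
  ultimately show ?thesis
    using rl_integral_left_by_parts[of "\<beta> + 1" _ a b f f', OF _ _ f' cont] pos t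
    by (auto intro: has_vector_derivative_transform[OF t, rotated])
qed

text \<open>
  After one integration by parts only the power \<open>(t - a) powr \<beta>\<close> obstructs differentiability,
  and it does so at \<open>t = a\<close> alone. With \<open>\<beta> = 1 - \<alpha>\<close> this gives the existence of the left fractional
  derivative. Two derivatives of \<open>f\<close> are used: one for the integration by parts, one to
  differentiate the integral of \<open>f'\<close>.
\<close>
lemma rl_integral_left_differentiable:
  fixes f :: "real \<Rightarrow> 'a::euclidean_space"
  assumes "\<beta> \<ge> 0" and t: "t \<in> {a<..<b}"
    and f': "\<And>t. t \<in> {a..b} \<Longrightarrow> (f has_vector_derivative f' t) (at t within {a..b})"
    and f'': "\<And>t. t \<in> {a..b} \<Longrightarrow> (f' has_vector_derivative f'' t) (at t within {a..b})"
    and cont: "continuous_on {a..b} f''"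
  shows "rl_integral_left a \<beta> f differentiable (at t)"
proof (cases "\<beta> = 0")
  case True
  then have "rl_integral_left a \<beta> f = f" by (auto simp: rl_integral_left_def)
  then show ?thesis
    using f'[of t] t by (auto simp: at_within_Icc_at intro: differentiableI_vector)
next
  case False
  with assms(1) have pos: "\<beta> > 0" by simp
  have cf': "continuous_on {a..b} f'"
    using f'' by (meson continuous_on_eq_continuous_within has_vector_derivative_continuous)
  have tt: "t \<in> {a..b}" using t by auto
  have "((\<lambda>s. ((s - a) powr \<beta> / Gamma (\<beta> + 1))) has_real_derivative
      \<beta> * (t - a) powr (\<beta> - 1) / Gamma (\<beta> + 1)) (at t within {a..b})"
    using t by (intro DERIV_cdivide) (auto intro!: derivative_eq_intros has_real_derivative_powr)
  then have "((\<lambda>s. ((s - a) powr \<beta> / Gamma (\<beta> + 1)) *\<^sub>R f a + rl_integral_left a (\<beta> + 1) f' s)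
      has_vector_derivative (\<beta> * (t - a) powr (\<beta> - 1) / Gamma (\<beta> + 1)) *\<^sub>R f a
        + rl_integral_left a \<beta> f' t) (at t within {a..b})"
    using has_vector_derivative_add[OF
      has_vector_derivative_scaleR[OF _ has_vector_derivative_const[of "f a"]]
      rl_integral_left_has_derivative[OF assms(1) tt f'' cont]]
    by simp
  then have "(rl_integral_left a \<beta> f has_vector_derivative
      (\<beta> * (t - a) powr (\<beta> - 1) / Gamma (\<beta> + 1)) *\<^sub>R f a + rl_integral_left a \<beta> f' t)
      (at t within {a..b})"
    by (rule has_vector_derivative_transform[OF tt, rotated])
       (use rl_integral_left_by_parts[OF pos _ f' cf'] in auto)
  then show ?thesis
    using t by (auto simp: at_within_Icc_at intro: differentiableI_vector)
qed

section \<open>Right integrals by reflection\<close>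

lemma rl_integral_right_reflect:
  "rl_integral_right b \<beta> f t = rl_integral_left (- b) \<beta> (\<lambda>y. f (- y)) (- t)"
  using Henstock_Kurzweil_Integration.integral_reflect_real[of b t "\<lambda>y. (y - t) powr (\<beta> - 1) *\<^sub>R f y"]
  by (simp add: rl_integral_left_def rl_integral_right_def minus_diff_commute add.commute)

lemma has_vector_derivative_reflect:
  fixes f :: "real \<Rightarrow> 'a::real_normed_vector"
  assumes "(f has_vector_derivative D) (at (- t) within {- b..- a})"
  shows "((\<lambda>y. f (- y)) has_vector_derivative - D) (at t within {a..b})"
proof -
  have "uminus ` {a..b} = {-b..-a}" by simp
  moreover have "(uminus has_vector_derivative - 1) (at t within {a..b})"
    by (auto intro!: derivative_eq_intros)
  ultimately show ?thesis
    using vector_diff_chain_within[of uminus "-1" t "{a..b}" f D] assms by (simp add: o_def)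
qed

lemma rl_integral_right_has_derivative:
  fixes f :: "real \<Rightarrow> 'a::euclidean_space"
  assumes "\<beta> \<ge> 0" and t: "t \<in> {a..b}"
    and f': "\<And>t. t \<in> {a..b} \<Longrightarrow> (f has_vector_derivative f' t) (at t within {a..b})"
    and cont: "continuous_on {a..b} f'"
  shows "(rl_integral_right b (\<beta> + 1) f has_vector_derivative - rl_integral_right b \<beta> f t)
    (at t within {a..b})"
proof -
  have "(rl_integral_left (- b) (\<beta> + 1) (\<lambda>y. f (- y)) has_vector_derivative
      rl_integral_left (- b) \<beta> (\<lambda>y. f (- y)) (- t)) (at (- t) within {- b..- a})"
  proof (rule rl_integral_left_has_derivative[OF assms(1)])
    show "continuous_on {- b..- a} (\<lambda>y. - f' (- y))"
      by (intro continuous_intros continuous_on_compose2[OF cont]) auto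
  qed (use t f' in \<open>auto intro!: has_vector_derivative_reflect\<close>)
  from has_vector_derivative_reflect[OF this]
  show ?thesis by (simp add: rl_integral_right_reflect[abs_def])
qed

lemma rl_integral_right_differentiable:
  fixes f :: "real \<Rightarrow> 'a::euclidean_space"
  assumes "\<beta> \<ge> 0" and t: "t \<in> {a<..<b}"
    and f': "\<And>t. t \<in> {a..b} \<Longrightarrow> (f has_vector_derivative f' t) (at t within {a..b})"
    and f'': "\<And>t. t \<in> {a..b} \<Longrightarrow> (f' has_vector_derivative f'' t) (at t within {a..b})"
    and cont: "continuous_on {a..b} f''"
  shows "rl_integral_right b \<beta> f differentiable (at t)"
proof -
  have "rl_integral_left (- b) \<beta> (\<lambda>y. f (- y)) differentiable (at (- t))"
  proof (rule rl_integral_left_differentiable[OF assms(1)])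
    show "((\<lambda>y. - f' (- y)) has_vector_derivative f'' (- s)) (at s within {- b..- a})"
      if "s \<in> {- b..- a}" for s
      using has_vector_derivative_minus[OF has_vector_derivative_reflect[of f' "f'' (- s)" s "- a" "- b"]] f''[of "- s"] that
      by simp
    show "continuous_on {- b..- a} (\<lambda>y. f'' (- y))"
      by (intro continuous_intros continuous_on_compose2[OF cont]) auto
  qed (use t f' in \<open>auto intro!: has_vector_derivative_reflect\<close>)
  then have "(\<lambda>s. rl_integral_left (- b) \<beta> (\<lambda>y. f (- y)) (- s)) differentiable (at t)"
    using differentiable_chain_at[of uminus t] by (simp add: o_def differentiable_minus)
  then show ?thesis by (simp add: rl_integral_right_reflect[abs_def])
qed

section \<open>Fractional derivatives of smooth functions\<close>

lemma nth_deriv_has_vector_derivative: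
  assumes "smooth_on_interval a b f" "t \<in> {a..b}"
  shows "(nth_deriv a b r f has_vector_derivative nth_deriv a b (Suc r) f t) (at t within {a..b})"
  using assms by (auto simp: smooth_on_interval_def differentiable_on_def vector_derivative_works)

lemma continuous_on_nth_deriv:
  assumes "smooth_on_interval a b f"
  shows "continuous_on {a..b} (nth_deriv a b r f)"
  using assms by (auto simp: smooth_on_interval_def differentiable_imp_continuous_on)

lemma smooth_has_rl_deriv_left:
  fixes f :: "real \<Rightarrow> 'a::euclidean_space"
  assumes "smooth_on_interval a b f" "\<alpha> \<le> 1" and t: "t \<in> {a<..<b}"
  shows "(rl_integral_left a (1 - \<alpha>) f has_vector_derivative rl_deriv_left a b \<alpha> f t) (at t)"
proof -
  have "rl_integral_left a (1 - \<alpha>) f differentiable (at t)"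
    using assms(2)
    by (intro rl_integral_left_differentiable[OF _ t
          nth_deriv_has_vector_derivative[OF assms(1), of _ 0, unfolded nth_deriv.simps(1)]
          nth_deriv_has_vector_derivative[OF assms(1)] continuous_on_nth_deriv[OF assms(1)]]) simp
  then show ?thesis
    using t by (simp add: rl_deriv_left_def at_within_Icc_at vector_derivative_works)
qed

lemma smooth_has_rl_deriv_right:
  fixes g :: "real \<Rightarrow> 'a::euclidean_space"
  assumes "smooth_on_interval a b g" "\<alpha> \<le> 1" and t: "t \<in> {a<..<b}"
  shows "(rl_integral_right b (1 - \<alpha>) g has_vector_derivative - rl_deriv_right a b \<alpha> g t) (at t)"
proof -
  have "rl_integral_right b (1 - \<alpha>) g differentiable (at t)"
    using assms(2)
    by (intro rl_integral_right_differentiable[OF _ t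
          nth_deriv_has_vector_derivative[OF assms(1), of _ 0, unfolded nth_deriv.simps(1)]
          nth_deriv_has_vector_derivative[OF assms(1)] continuous_on_nth_deriv[OF assms(1)]]) simp
  then show ?thesis
    using t by (simp add: rl_deriv_right_def at_within_Icc_at vector_derivative_works)
qed

section \<open>Termwise differentiation of the series\<close>

text \<open>
  In a telescoping series of derivatives, uniform convergence is the convergence of \<open>w\<close> to 0. The
  term \<open>x 0\<close> is kept apart because it need not be differentiable at the endpoints; the
  other terms sum to a function with derivative \<open>w 0\<close>, which the derivative of \<open>x 0\<close> compensates.
  Vanishing at one point \<open>c\<close> supplies the convergence at a point.
\<close>
lemma telescoping_series_has_derivative:
  fixes x w :: "nat \<Rightarrow> real \<Rightarrow> real"
  assumes head: "\<And>t. t \<in> {a<..<b} \<Longrightarrow> (x 0 has_real_derivative D t - w 0 t) (at t)"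
    and step: "\<And>n t. t \<in> {a..b} \<Longrightarrow>
      (x (Suc n) has_real_derivative w n t - w (Suc n) t) (at t within {a..b})"
    and lim: "uniform_limit {a..b} w (\<lambda>t. 0) sequentially"
    and base: "c \<in> {a..b}" "\<And>n. x (Suc n) c = 0"
  obtains X where "\<And>t. t \<in> {a..b} \<Longrightarrow> (\<lambda>n. x n t) sums X t"
    and "\<And>t. t \<in> {a<..<b} \<Longrightarrow> (X has_real_derivative D t) (at t)"
proof -
  have "uniform_limit {a..b} (\<lambda>n t. w 0 t - w n t) (\<lambda>t. w 0 t - 0) sequentially"
    using lim by (intro uniform_limit_intros)
  moreover have "(\<Sum>i<n. w i t - w (Suc i) t) = w 0 t - w n t" for n t
    by (rule sum_lessThan_telescope')
  ultimately have "uniform_limit {a..b} (\<lambda>n t. \<Sum>i<n. w i t - w (Suc i) t) (w 0) sequentially"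
    by simp
  moreover have "summable (\<lambda>n. x (Suc n) c)" using base(2) by simp
  ultimately obtain U where U: "\<forall>t\<in>{a..b}. (\<lambda>n. x (Suc n) t) sums U t \<and>
      (U has_real_derivative w 0 t) (at t within {a..b})"
    using has_field_derivative_series[where f' = "\<lambda>n t. w n t - w (Suc n) t",
        OF convex_real_interval(5) step _ base(1)]
    by blast
  show ?thesis
  proof (rule that)
    show "(\<lambda>n. x n t) sums (U t + x 0 t)" if "t \<in> {a..b}" for t
      using U that by (intro sums_Suc) auto
  next
    fix t assume t: "t \<in> {a<..<b}"
    then have "(U has_real_derivative w 0 t) (at t)"
      using U[rule_format, of t] by (auto simp: at_within_Icc_at)
    from DERIV_add[OF this head[OF t]]
    show "((\<lambda>t. U t + x 0 t) has_real_derivative D t) (at t)" by simp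
  qed
qed

lemma has_real_derivative_inner:
  fixes f g :: "real \<Rightarrow> 'a::real_inner"
  assumes "(f has_vector_derivative f') (at t within S)" "(g has_vector_derivative g') (at t within S)"
  shows "((\<lambda>t. f t \<bullet> g t) has_real_derivative f t \<bullet> g' + f' \<bullet> g t) (at t within S)"
  using bounded_bilinear.has_vector_derivative[OF bounded_bilinear_inner assms]
  by (simp add: has_real_derivative_iff_has_vector_derivative)

text \<open>
  The sign \<open>(-1)\<^sup>r\<close> turns the sums \<open>v\<^sub>r + v\<^sub>r\<^sub>+\<^sub>1\<close> into differences, so the telescoping sequence is
  the alternating one, \<open>(-1)\<^sup>r v\<^sub>r\<close>. The series is anchored at \<open>a\<close>, where left integrals of positive
  order vanish. Both \<open>v\<close> and \<open>w\<close> are shifted in the proof: index \<open>n\<close> stands for the order \<open>n + 1\<close>.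
\<close>
lemma left_series_has_derivative:
  fixes f g :: "real \<Rightarrow> 'a::euclidean_space"
  assumes "a < b" "\<alpha> \<le> 1"
    and smooth: "smooth_on_interval a b f" "smooth_on_interval a b g"
    and lim: "uniform_limit {a..b}
      (\<lambda>p t. rl_integral_left a (real (Suc p) - \<alpha>) f t \<bullet> nth_deriv a b (Suc p) g t)
      (\<lambda>t. 0) sequentially"
  obtains X where
    "\<And>t. t \<in> {a..b} \<Longrightarrow>
      (\<lambda>r. (-1) ^ r * (rl_integral_left a (real r + 1 - \<alpha>) f t \<bullet> nth_deriv a b r g t)) sums X t"
    and "\<And>t. t \<in> {a<..<b} \<Longrightarrow> (X has_real_derivative rl_deriv_left a b \<alpha> f t \<bullet> g t) (at t)"
proof -
  let ?I = "\<lambda>\<beta>. rl_integral_left a \<beta> f" and ?g = "\<lambda>r. nth_deriv a b r g"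
  define v where "v n t = ?I (real (Suc n) - \<alpha>) t \<bullet> ?g (Suc n) t" for n t
  define w where "w n t = (-1) ^ Suc n * v n t" for n t
  define x where "x r t = (-1) ^ r * (?I (real r + 1 - \<alpha>) t \<bullet> ?g r t)" for r t
  note f' = nth_deriv_has_vector_derivative[OF smooth(1)]
    and g' = nth_deriv_has_vector_derivative[OF smooth(2)]
  have wlim: "uniform_limit {a..b} w (\<lambda>t. 0) sequentially"
    using lim unfolding uniform_limit_iff w_def v_def by (simp add: abs_mult power_abs)
  have step: "(x (Suc n) has_real_derivative w n t - w (Suc n) t) (at t within {a..b})"
    if t: "t \<in> {a..b}" for n t
  proof -
    have "(?I (real (Suc n) - \<alpha> + 1) has_vector_derivative ?I (real (Suc n) - \<alpha>) t) (at t within {a..b})"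
      using t assms(2) f'[of _ 0] continuous_on_nth_deriv[OF smooth(1), of "Suc 0"]
      by (intro rl_integral_left_has_derivative[where f' = "nth_deriv a b (Suc 0) f"]) auto
    moreover have "real (Suc n) - \<alpha> + 1 = real (Suc n) + 1 - \<alpha>" by simp
    ultimately have "(?I (real (Suc n) + 1 - \<alpha>) has_vector_derivative ?I (real (Suc n) - \<alpha>) t)
        (at t within {a..b})" by metis
    from DERIV_cmult[OF has_real_derivative_inner[OF this g'[OF t, of "Suc n"]], of "(-1) ^ Suc n"]
    show ?thesis by (simp add: x_def[abs_def] w_def v_def algebra_simps)
  qed
  have head: "(x 0 has_real_derivative rl_deriv_left a b \<alpha> f t \<bullet> g t - w 0 t) (at t)"
    if t: "t \<in> {a<..<b}" for t
    using has_real_derivative_inner[OF smooth_has_rl_deriv_left[OF smooth(1) assms(2) t], of g] g'[of t 0] t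
    by (auto simp: x_def[abs_def] w_def v_def at_within_Icc_at add.commute)
  have base: "x (Suc n) a = 0" for n
    using assms(2) by (simp add: x_def rl_integral_left_base)
  have "a \<in> {a..b}" using assms(1) by simp
  from telescoping_series_has_derivative[where x = x, OF head step wlim this base] that
  show ?thesis unfolding x_def by blast
qed

text \<open>
  The product rule already yields differences here, since right integrals differentiate with a minus
  sign; the anchor is \<open>b\<close>, where they vanish.
\<close>
lemma right_series_has_derivative:
  fixes f g :: "real \<Rightarrow> 'a::euclidean_space"
  assumes "a < b" "\<alpha> \<le> 1"
    and smooth: "smooth_on_interval a b f" "smooth_on_interval a b g"
    and lim: "uniform_limit {a..b}
      (\<lambda>p t. nth_deriv a b (Suc p) f t \<bullet> rl_integral_right b (real (Suc p) - \<alpha>) g t)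
      (\<lambda>t. 0) sequentially"
  obtains X where
    "\<And>t. t \<in> {a..b} \<Longrightarrow>
      (\<lambda>r. nth_deriv a b r f t \<bullet> rl_integral_right b (real r + 1 - \<alpha>) g t) sums X t"
    and "\<And>t. t \<in> {a<..<b} \<Longrightarrow> (X has_real_derivative - (f t \<bullet> rl_deriv_right a b \<alpha> g t)) (at t)"
proof -
  let ?I = "\<lambda>\<beta>. rl_integral_right b \<beta> g" and ?f = "\<lambda>r. nth_deriv a b r f"
  define w where "w n t = - (?f (Suc n) t \<bullet> ?I (real (Suc n) - \<alpha>) t)" for n t
  define x where "x r t = ?f r t \<bullet> ?I (real r + 1 - \<alpha>) t" for r t
  note f' = nth_deriv_has_vector_derivative[OF smooth(1)]
    and g' = nth_deriv_has_vector_derivative[OF smooth(2)]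
  have wlim: "uniform_limit {a..b} w (\<lambda>t. 0) sequentially"
    using lim unfolding uniform_limit_iff w_def by simp
  have step: "(x (Suc n) has_real_derivative w n t - w (Suc n) t) (at t within {a..b})"
    if t: "t \<in> {a..b}" for n t
  proof -
    have "(?I (real (Suc n) - \<alpha> + 1) has_vector_derivative - ?I (real (Suc n) - \<alpha>) t) (at t within {a..b})"
      using t assms(2) g'[of _ 0] continuous_on_nth_deriv[OF smooth(2), of "Suc 0"]
      by (intro rl_integral_right_has_derivative[where f' = "nth_deriv a b (Suc 0) g"]) auto
    moreover have "real (Suc n) - \<alpha> + 1 = real (Suc n) + 1 - \<alpha>" by simp
    ultimately have "(?I (real (Suc n) + 1 - \<alpha>) has_vector_derivative - ?I (real (Suc n) - \<alpha>) t)
        (at t within {a..b})" by metis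
    from has_real_derivative_inner[OF f'[OF t, of "Suc n"] this]
    show ?thesis by (simp add: x_def[abs_def] w_def algebra_simps)
  qed
  have head: "(x 0 has_real_derivative - (f t \<bullet> rl_deriv_right a b \<alpha> g t) - w 0 t) (at t)"
    if t: "t \<in> {a<..<b}" for t
    using has_real_derivative_inner[OF _ smooth_has_rl_deriv_right[OF smooth(2) assms(2) t], of f] f'[of t 0] t
    by (auto simp: x_def[abs_def] w_def at_within_Icc_at)
  have base: "x (Suc n) b = 0" for n
    using assms(2) by (simp add: x_def rl_integral_right_reflect rl_integral_left_base)
  have "b \<in> {a..b}" using assms(1) by simp
  from telescoping_series_has_derivative[where x = x, OF head step wlim this base] that
  show ?thesis unfolding x_def by blast
qed

section \<open>The derivative of the infinite sum\<close>

theorem theorem5: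
  fixes a b \<alpha> :: real and f g :: "real \<Rightarrow> real ^ 'd"
  assumes "a < b" and "0 < \<alpha>" and "\<alpha> \<le> 1"
    and "smooth_on_interval a b f" and "smooth_on_interval a b g"
    and "uniform_limit {a..b}
           (\<lambda>p t. rl_integral_left a (real (Suc p) - \<alpha>) f t \<bullet> nth_deriv a b (Suc p) g t)
           (\<lambda>t. 0) sequentially"
    and "uniform_limit {a..b}
           (\<lambda>p t. nth_deriv a b (Suc p) f t \<bullet> rl_integral_right b (real (Suc p) - \<alpha>) g t)
           (\<lambda>t. 0) sequentially"
  shows "\<forall>t\<in>{a<..<b}.
    rl_integral_left a (1 - \<alpha>) f differentiable (at t) \<and>
    rl_integral_right b (1 - \<alpha>) g differentiable (at t) \<and>
    summable (\<lambda>r. (-1) ^ r * (rl_integral_left a (real r + 1 - \<alpha>) f t \<bullet> nth_deriv a b r g t)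
                  + nth_deriv a b r f t \<bullet> rl_integral_right b (real r + 1 - \<alpha>) g t) \<and>
    ((\<lambda>s. \<Sum>r. (-1) ^ r * (rl_integral_left a (real r + 1 - \<alpha>) f s \<bullet> nth_deriv a b r g s)
                  + nth_deriv a b r f s \<bullet> rl_integral_right b (real r + 1 - \<alpha>) g s)
       has_real_derivative
         (rl_deriv_left a b \<alpha> f t \<bullet> g t - f t \<bullet> rl_deriv_right a b \<alpha> g t)) (at t)"
proof
  fix t assume t: "t \<in> {a<..<b}"
  obtain X where X:
    "\<And>t. t \<in> {a..b} \<Longrightarrow>
      (\<lambda>r. (-1) ^ r * (rl_integral_left a (real r + 1 - \<alpha>) f t \<bullet> nth_deriv a b r g t)) sums X t"
    "\<And>t. t \<in> {a<..<b} \<Longrightarrow> (X has_real_derivative rl_deriv_left a b \<alpha> f t \<bullet> g t) (at t)"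
    using left_series_has_derivative[OF assms(1,3-6)] by blast
  obtain Y where Y:
    "\<And>t. t \<in> {a..b} \<Longrightarrow>
      (\<lambda>r. nth_deriv a b r f t \<bullet> rl_integral_right b (real r + 1 - \<alpha>) g t) sums Y t"
    "\<And>t. t \<in> {a<..<b} \<Longrightarrow> (Y has_real_derivative - (f t \<bullet> rl_deriv_right a b \<alpha> g t)) (at t)"
    using right_series_has_derivative[OF assms(1,3-5,7)] by blast
  let ?z = "\<lambda>t r. (-1) ^ r * (rl_integral_left a (real r + 1 - \<alpha>) f t \<bullet> nth_deriv a b r g t)
    + nth_deriv a b r f t \<bullet> rl_integral_right b (real r + 1 - \<alpha>) g t"
  have sums: "?z s sums (X s + Y s)" if "s \<in> {a<..<b}" for s
    using that by (intro sums_add X(1) Y(1)) auto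
  have "((\<lambda>s. X s + Y s) has_real_derivative
      rl_deriv_left a b \<alpha> f t \<bullet> g t - f t \<bullet> rl_deriv_right a b \<alpha> g t) (at t)"
    using DERIV_add[OF X(2)[OF t] Y(2)[OF t]] by simp
  then have "((\<lambda>s. \<Sum>r. ?z s r) has_real_derivative
      rl_deriv_left a b \<alpha> f t \<bullet> g t - f t \<bullet> rl_deriv_right a b \<alpha> g t) (at t)"
    by (rule has_field_derivative_transform_within_open[where S = "{a<..<b}"])
       (use t sums in \<open>auto simp: sums_iff\<close>)
  moreover have "summable (?z t)"
    using sums[OF t] by (rule sums_summable)
  moreover have "rl_integral_left a (1 - \<alpha>) f differentiable (at t)"
    "rl_integral_right b (1 - \<alpha>) g differentiable (at t)"
    using smooth_has_rl_deriv_left[OF assms(4,3) t] smooth_has_rl_deriv_right[OF assms(5,3) t]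
    by (auto intro: differentiableI_vector)
  ultimately show "rl_integral_left a (1 - \<alpha>) f differentiable (at t) \<and>
      rl_integral_right b (1 - \<alpha>) g differentiable (at t) \<and> summable (?z t) \<and>
      ((\<lambda>s. \<Sum>r. ?z s r) has_real_derivative
        rl_deriv_left a b \<alpha> f t \<bullet> g t - f t \<bullet> rl_deriv_right a b \<alpha> g t) (at t)"
    by blast
qed

end
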